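(* Let $\mathcal{X}=\{K\cup A : K\subseteq\mathbb{R}^2 \text{ compact},\ A\subseteq\mathbb{R}^2\text{ open and bounded}\}$, $\mathcal{Y}=\{K\cap A : K\subseteq\mathbb{R}^2 \text{ compact},\ A\subseteq\mathbb{R}^2\text{ open and bounded}\}$, $\mathcal{E}=\mathcal{X}\cup\mathcal{Y}$, and $\mathcal{F}=\mathcal{E}\cup\{S\subseteq\mathbb{R}^2 : S^c\in\mathcal{E}\}$, where $S^c=\mathbb{R}^2\setminus S$. Then each of the classes $\mathcal{X}$, $\mathcal{Y}$, $\mathcal{E}$ and $\mathcal{F}$ is a good class.
   Context: A figure is any subset of $\mathbb{R}^2$. An isometry is a map $f:\mathbb{R}^2\to\mathbb{R}^2$ preserving the Euclidean distance. For figures $S_1,S_2$: $S_1\approx S_2$ means there is an isometry $f$ of $\mathbb{R}^2$ with $f(S_1)=S_2$; $S_1\le S_2$ means there is an isometry $f$ of $\mathbb{R}^2$ with $f(S_1)\subseteq S_2$. A class $\mathcal{C}$ of figures is good if there are no figures $A,B\in\mathcal{C}$ such that $A\le B$, $B\le A$ and $A\not\approx B$. *)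

theory Defs
  imports "HOL-Analysis.Analysis"
begin

type_synonym figure = "(real ^ 2) set"

text \<open>Surjectivity is not required: an isometry is any distance-preserving self-map of the plane.\<close>

definition plane_isometry :: "(real ^ 2 \<Rightarrow> real ^ 2) \<Rightarrow> bool" where
  "plane_isometry f \<longleftrightarrow> (\<forall>x y. dist (f x) (f y) = dist x y)"

definition fig_congruent :: "figure \<Rightarrow> figure \<Rightarrow> bool" where
  "fig_congruent S1 S2 \<longleftrightarrow> (\<exists>f. plane_isometry f \<and> f ` S1 = S2)"

definition fig_le :: "figure \<Rightarrow> figure \<Rightarrow> bool" where
  "fig_le S1 S2 \<longleftrightarrow> (\<exists>f. plane_isometry f \<and> f ` S1 \<subseteq> S2)"

definition good_class :: "figure set \<Rightarrow> bool" where
  "good_class C \<longleftrightarrow>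
     \<not> (\<exists>A\<in>C. \<exists>B\<in>C. fig_le A B \<and> fig_le B A \<and> \<not> fig_congruent A B)"

definition class_X :: "figure set" where
  "class_X = {K \<union> A | K A. compact K \<and> open A \<and> bounded A}"

definition class_Y :: "figure set" where
  "class_Y = {K \<inter> A | K A. compact K \<and> open A \<and> bounded A}"

definition class_E :: "figure set" where
  "class_E = class_X \<union> class_Y"

definition class_F :: "figure set" where
  "class_F = class_E \<union> {S. - S \<in> class_E}"

end

theory Submission
  imports Defs
begin

text \<open>
  If \<open>f ` A \<subseteq> B\<close> and \<open>g ` B \<subseteq> A\<close>, then \<open>h = g \<circ> f\<close> maps \<open>A\<close> into itself, and \<open>h ` A = A\<close>
  would force \<open>g ` B = A\<close>. So it suffices that no member of \<open>class_F\<close> is congruent to a proper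
  subset of itself. Points of a bounded set mapped into itself by an isometry are recurrent, which
  gives this property for compact sets and for bounded open sets. A set \<open>S = K \<union> U\<close> is the union of
  its interior and the compact set \<open>S - interior S\<close>; a set \<open>S = K \<inter> U\<close> is the difference of the
  compact sets \<open>closure S\<close> and \<open>closure S - S\<close>. Complements are handled by passing to the inverse
  isometry.
\<close>

text \<open>Subtracting \<open>h 0\<close> leaves a distance-preserving map that fixes the origin.
  Such a map is linear and orthogonal, hence onto in finite dimension.\<close>

lemma isometry_bij:
  fixes h :: "'a::euclidean_space \<Rightarrow> 'a"
  assumes iso: "\<And>x y. dist (h x) (h y) = dist x y"
  shows "bij h"
proof -
  define T where "T = (\<lambda>x. h x - h 0)"
  have "orthogonal_transformation T"
    unfolding orthogonal_transformation_isometry T_def using iso by (simp add: dist_norm)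
  then have "bij ((+) (h 0) \<circ> T)"
    by (intro bij_comp bij_plus orthogonal_transformation_bij)
  moreover have "(+) (h 0) \<circ> T = h"
    by (auto simp: T_def)
  ultimately show ?thesis
    by simp
qed

lemma isometry_inv:
  fixes h :: "'a::euclidean_space \<Rightarrow> 'a"
  assumes iso: "\<And>x y. dist (h x) (h y) = dist x y"
  shows "dist (inv h x) (inv h y) = dist x y"
  using iso[of "inv h x" "inv h y"] isometry_bij[OF iso] by (simp add: bij_is_surj surj_f_inv_f)

lemma isometry_continuous_on:
  fixes h :: "'a::metric_space \<Rightarrow> 'b::metric_space"
  assumes iso: "\<And>x y. dist (h x) (h y) = dist x y"
  shows "continuous_on S h"
  unfolding continuous_on_iff using iso by auto

lemma isometry_funpow:
  fixes h :: "'a::metric_space \<Rightarrow> 'a"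
  assumes iso: "\<And>x y. dist (h x) (h y) = dist x y"
  shows "dist ((h ^^ n) x) ((h ^^ n) y) = dist x y"
  by (induction n) (simp_all add: iso)

lemma funpow_image_subset:
  assumes "h ` S \<subseteq> S" "x \<in> S"
  shows "(h ^^ n) x \<in> S"
  using assms by (induction n) auto

text \<open>A bounded orbit has a Cauchy subsequence, so two of its terms are close; cancelling the
  common iterations, which preserve distance, brings \<open>x\<close> back near itself. The exponent
  \<open>Suc n\<close> excludes the trivial return after zero steps.\<close>

lemma isometry_recurrent:
  fixes h :: "'a::heine_borel \<Rightarrow> 'a"
  assumes iso: "\<And>x y. dist (h x) (h y) = dist x y"
    and S: "bounded S" "h ` S \<subseteq> S" "x \<in> S" and "e > 0"
  obtains n where "dist ((h ^^ Suc n) x) x < e"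
proof -
  have "range (\<lambda>n. (h ^^ n) x) \<subseteq> S"
    using funpow_image_subset[OF S(2,3)] by auto
  then have "bounded (range (\<lambda>n. (h ^^ n) x))"
    using S(1) bounded_subset by blast
  then obtain l r where r: "strict_mono (r :: nat \<Rightarrow> nat)"
    and "((\<lambda>n. (h ^^ n) x) \<circ> r) \<longlonglongrightarrow> l"
    using bounded_imp_convergent_subsequence by blast
  then have "Cauchy ((\<lambda>n. (h ^^ n) x) \<circ> r)"
    by (simp add: LIMSEQ_imp_Cauchy)
  then obtain N where N: "dist ((h ^^ r (Suc N)) x) ((h ^^ r N) x) < e"
    using \<open>e > 0\<close> unfolding Cauchy_def by (metis comp_apply le_Suc_eq order_refl)
  have "r N < r (Suc N)"
    using r by (simp add: strict_mono_Suc_iff)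
  then obtain n where "r (Suc N) = r N + Suc n"
    using less_imp_Suc_add by fastforce
  then have "dist ((h ^^ Suc n) x) x = dist ((h ^^ r (Suc N)) x) ((h ^^ r N) x)"
    by (simp only: funpow_add comp_apply isometry_funpow[OF iso])
  then show thesis
    using N that by metis
qed

lemma isometry_compact_image_eq:
  fixes h :: "'a::heine_borel \<Rightarrow> 'a"
  assumes iso: "\<And>x y. dist (h x) (h y) = dist x y"
    and C: "compact C" "h ` C \<subseteq> C"
  shows "h ` C = C"
proof
  show "C \<subseteq> h ` C"
  proof
    fix x assume x: "x \<in> C"
    have "closed (h ` C)"
      by (intro compact_imp_closed compact_continuous_image C isometry_continuous_on iso)
    \<comment> \<open>Each return takes at least one step, so the returning point is an image under
      \<open>h\<close> of a point of \<open>C\<close>.\<close>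
    moreover have "x \<in> closure (h ` C)"
      unfolding closure_approachable
    proof (intro allI impI)
      fix e :: real assume "e > 0"
      then obtain n where "dist ((h ^^ Suc n) x) x < e"
        using isometry_recurrent[OF iso compact_imp_bounded[OF C(1)] C(2) x] by blast
      then show "\<exists>y\<in>h ` C. dist y x < e"
        using funpow_image_subset[OF C(2) x, of n] by auto
    qed
    ultimately show "x \<in> h ` C"
      by simp
  qed
qed (rule C)

text \<open>Recurrence run backwards: the point \<open>y\<close> that reaches \<open>x\<close> after
  \<open>Suc n\<close> steps is as close to \<open>x\<close> as \<open>x\<close> is to its own
  return. Openness then puts \<open>y\<close> in \<open>U\<close>, and \<open>x\<close> is the image
  of \<open>(h ^^ n) y\<close>.\<close>

lemma isometry_open_image_eq:
  fixes h :: "'a::heine_borel \<Rightarrow> 'a"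
  assumes iso: "\<And>x y. dist (h x) (h y) = dist x y" and "surj h"
    and U: "open U" "bounded U" "h ` U \<subseteq> U"
  shows "h ` U = U"
proof
  show "U \<subseteq> h ` U"
  proof
    fix x assume x: "x \<in> U"
    obtain e where e: "e > 0" "ball x e \<subseteq> U"
      using U(1) x open_contains_ball by blast
    obtain n where n: "dist ((h ^^ Suc n) x) x < e"
      using isometry_recurrent[OF iso U(2,3) x e(1)] by blast
    obtain y where y: "(h ^^ Suc n) y = x"
      using surj_fn[OF \<open>surj h\<close>] by (metis surjD)
    have "dist x y < e"
      using n isometry_funpow[OF iso, of "Suc n" x y] unfolding y by (simp add: dist_commute)
    then have "(h ^^ n) y \<in> U"
      using e(2) funpow_image_subset[OF U(3)] by auto
    then show "x \<in> h ` U"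
      using y by auto
  qed
qed (rule U)

lemma isometry_compact_Un_open_image_eq:
  fixes h :: "'a::euclidean_space \<Rightarrow> 'a"
  assumes iso: "\<And>x y. dist (h x) (h y) = dist x y"
    and "compact K" "open U" "bounded U" and S: "S = K \<union> U" "h ` S \<subseteq> S"
  shows "h ` S = S"
proof -
  have bij: "bij h"
    by (rule isometry_bij[OF iso])
  \<comment> \<open>The image of an open set under \<open>h\<close> is its preimage under the
    continuous \<open>inv h\<close>, so \<open>h\<close> maps the interior into the
    interior.\<close>
  have "open (inv h -` interior S)"
    by (intro open_vimage open_interior isometry_continuous_on isometry_inv iso)
  then have "open (h ` interior S)"
    using bij by (simp add: bij_vimage_eq_inv_image inv_inv_eq bij_imp_bij_inv)
  then have "h ` interior S \<subseteq> interior S"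
    using S(2) interior_subset by (intro interior_maximal) blast+
  moreover have "bounded (interior S)"
    using assms by (meson bounded_Un bounded_subset compact_imp_bounded interior_subset)
  ultimately have int: "h ` interior S = interior S"
    using isometry_open_image_eq[OF iso bij_is_surj[OF bij]] by simp
  have "U \<subseteq> interior S"
    using assms by (simp add: interior_maximal)
  then have "S - interior S = K - interior S"
    using S(1) by blast
  then have "compact (S - interior S)"
    using \<open>compact K\<close> by (simp add: compact_diff)
  \<comment> \<open>The interior is already the full image of itself, so by injectivity no other
    point of \<open>S\<close> lands in it.\<close>
  moreover have "h ` (S - interior S) \<subseteq> S - interior S"
    using S(2) int bij_is_inj[OF bij] by (metis Diff_mono image_set_diff order_refl)
  ultimately have "h ` (S - interior S) = S - interior S"
    by (rule isometry_compact_image_eq[OF iso])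
  then show ?thesis
    using int interior_subset[of S] by (metis Diff_partition image_Un)
qed

lemma isometry_compact_Int_open_image_eq:
  fixes h :: "'a::euclidean_space \<Rightarrow> 'a"
  assumes iso: "\<And>x y. dist (h x) (h y) = dist x y"
    and "compact K" "open U" and S: "S = K \<inter> U" "h ` S \<subseteq> S"
  shows "h ` S = S"
proof -
  have bij: "bij h"
    by (rule isometry_bij[OF iso])
  have K: "closure S \<subseteq> K"
    using assms by (simp add: closure_minimal compact_imp_closed)
  then have "compact (closure S)"
    using \<open>compact K\<close> by (metis closed_closure compact_Int_closed inf.absorb2)
  moreover have "h ` closure S \<subseteq> closure S"
    using S(2) closure_subset
    by (intro image_closure_subset isometry_continuous_on iso closed_closure) blast+
  ultimately have cl: "h ` closure S = closure S"
    by (rule isometry_compact_image_eq[OF iso])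
  \<comment> \<open>As the closure lies in \<open>K\<close>, membership of its points in
    \<open>S\<close> is decided by \<open>U\<close> alone; removing an open set keeps
    compactness.\<close>
  have "closure S - S = closure S - U"
    using K S(1) by blast
  then have "compact (closure S - S)"
    using \<open>compact (closure S)\<close> \<open>open U\<close> by (simp add: compact_diff)
  \<comment> \<open>The inverse is used because \<open>h\<close> might a priori carry points of the
    difference into \<open>S\<close>, whereas \<open>inv h\<close> cannot send a point outside
    \<open>S\<close> into \<open>S\<close>.\<close>
  moreover have "inv h ` (closure S - S) \<subseteq> closure S - S"
  proof -
    have "inv h ` closure S = closure S"
      using cl bij by (metis bij_is_inj image_inv_f_f)
    moreover have "inv h y \<notin> S" if "y \<notin> S" for y
      using that S(2) bij by (metis bij_is_surj image_subset_iff surj_f_inv_f)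
    ultimately show ?thesis by blast
  qed
  ultimately have "inv h ` (closure S - S) = closure S - S"
    by (rule isometry_compact_image_eq[OF isometry_inv[OF iso]])
  then have "h ` (closure S - S) = closure S - S"
    using bij by (metis bij_is_surj image_f_inv_f)
  then have "h ` (closure S - (closure S - S)) = closure S - (closure S - S)"
    using cl bij by (simp only: image_set_diff[OF bij_is_inj])
  moreover have "closure S - (closure S - S) = S"
    using closure_subset by blast
  ultimately show ?thesis by simp
qed

lemma class_E_image_eq:
  assumes "S \<in> class_E" "plane_isometry h" "h ` S \<subseteq> S"
  shows "h ` S = S"
proof -
  have iso: "dist (h x) (h y) = dist x y" for x y
    using assms(2) by (simp add: plane_isometry_def)
  consider K U where "S = K \<union> U" "compact K" "open U" "bounded U"
    | K U where "S = K \<inter> U" "compact K" "open U"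
    using assms(1) unfolding class_E_def class_X_def class_Y_def by blast
  then show ?thesis
  proof cases
    case 1
    then show ?thesis using isometry_compact_Un_open_image_eq[OF iso] assms(3) by metis
  next
    case 2
    then show ?thesis using isometry_compact_Int_open_image_eq[OF iso] assms(3) by metis
  qed
qed

lemma class_F_image_eq:
  assumes S: "S \<in> class_F" and h: "plane_isometry h" "h ` S \<subseteq> S"
  shows "h ` S = S"
proof (cases "S \<in> class_E")
  case True
  then show ?thesis using h class_E_image_eq by blast
next
  case False
  then have E: "- S \<in> class_E"
    using S by (simp add: class_F_def)
  have bij: "bij h" and inv: "plane_isometry (inv h)"
    using h(1) isometry_bij[of h] isometry_inv[of h] by (auto simp: plane_isometry_def)
  \<comment> \<open>A point sent into \<open>S\<close> by \<open>inv h\<close> would itself lie in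
    \<open>S\<close>, since \<open>h\<close> maps \<open>S\<close> into itself.\<close>
  have "inv h y \<notin> S" if "y \<notin> S" for y
    using that h(2) bij by (metis bij_is_surj image_subset_iff surj_f_inv_f)
  then have "inv h ` (- S) = - S"
    by (intro class_E_image_eq E inv) auto
  then have "h ` (- S) = - S"
    using bij by (metis bij_is_surj image_f_inv_f)
  then show ?thesis
    using bij by (metis bij_image_Compl_eq double_compl)
qed

lemma good_class_F: "good_class class_F"
  unfolding good_class_def
proof (intro notI, elim bexE conjE)
  fix A B assume A: "A \<in> class_F" and AB: "fig_le A B" "fig_le B A" "\<not> fig_congruent A B"
  obtain f g where f: "plane_isometry f" "f ` A \<subseteq> B" and g: "plane_isometry g" "g ` B \<subseteq> A"
    using AB unfolding fig_le_def by blast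
  have "plane_isometry (g \<circ> f)"
    using f g by (simp add: plane_isometry_def)
  moreover have "(g \<circ> f) ` A \<subseteq> A"
    using f(2) g(2) by fastforce
  ultimately have "(g \<circ> f) ` A = A"
    using class_F_image_eq[OF A] by blast
  \<comment> \<open>The image of \<open>B\<close> under \<open>g\<close> is squeezed between that of
    \<open>A\<close> under \<open>g \<circ> f\<close> and \<open>A\<close>, which coincide;
    cancelling \<open>g\<close> makes \<open>f\<close> a congruence.\<close>
  then have "g ` (f ` A) = g ` B"
    using f(2) g(2) by (metis image_comp image_mono subset_antisym)
  moreover have "inj g"
    using g(1) isometry_bij[of g] by (simp add: plane_isometry_def bij_is_inj)
  ultimately have "f ` A = B"
    by (simp add: inj_image_eq_iff)
  then show False
    using AB(3) f(1) unfolding fig_congruent_def by blast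
qed

lemma good_class_subset: "good_class D \<Longrightarrow> C \<subseteq> D \<Longrightarrow> good_class C"
  unfolding good_class_def by blast

theorem proposition1p11:
  shows "good_class class_X \<and> good_class class_Y \<and> good_class class_E \<and> good_class class_F"
proof -
  have "class_X \<subseteq> class_F" "class_Y \<subseteq> class_F" "class_E \<subseteq> class_F"
    by (auto simp: class_E_def class_F_def)
  then show ?thesis
    using good_class_F good_class_subset by blast
qed

end
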